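(* For every $1<p\le\infty$, the family of metric spaces $([0,1]^n,\|\cdot\|_p)_{n\ge1}$, with metric $\rho_n(x,y)=\|x-y\|_p$, is $\Psi$-dominated with respect to the Lebesgue measure $\mu$ on $[0,1]$.
   Context: For a metric space $(\mathcal X,\rho)$ with $\operatorname{diam}_\rho(\mathcal X)=\sup_{x,y}\rho(x,y)$, $\operatorname{Lip}(\mathcal X,\rho)$ is the set of $g:\mathcal X\to[0,\operatorname{diam}_\rho(\mathcal X)]$ with $|g(x)-g(y)|\le\rho(x,y)$ for all $x,y$. Let $(z)_+=\max(z,0)$ and let $\mu$ be a positive Borel measure on $\mathcal S$. For $f\in L_1(\mathcal S^n,\mu^n)$ put $(\pi f)(x_2,\dots,x_n)=\int_{\mathcal S}f(x_1,\dots,x_n)\,d\mu(x_1)$. Define $\Psi_0=0$ and $\Psi_n(f)=\int_{\mathcal S^n}(f)_+\,d\mu^n+\Psi_{n-1}(\pi f)$ for $n\ge1$. A family $(\mathcal S^n,\rho_n)_{n\ge1}$ of metric spaces is $\Psi$-dominated with respect to $\mu$ if (i) for all $n$, all $1\le i\le n$ and all $x,y\in\mathcal S^n$ with $x_i=y_i$, $\rho_n(x,y)=\rho_{n-1}(x',y')$, where $x',y'\in\mathcal S^{n-1}$ are obtained by deleting the $i$th coordinate (for $n=1$ this is void, both sides being $0$); (ii) for each $n$, $\mu^n=\mu\otimes\cdots\otimes\mu$ is a positive product measure on the Borel $\sigma$-algebra induced by $\rho_n$; and (iii) $\sup_{g\in\operatorname{Lip}(\mathcal S^n,\rho_n)}\int_{\mathcal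 S^n}fg\,d\mu^n\le\Psi_n(f)$ for every $n\ge1$ and every $f\in L_1(\mathcal S^n,\mu^n)$. *)

theory Defs
  imports "HOL-Analysis.Analysis"
begin

text \<open>
  A point of \<open>S\<^sup>n\<close> is an extensional function on \<open>{..<n}\<close>, so the coordinates
  \<open>x\<^sub>1, \<dots>, x\<^sub>n\<close> are \<open>x 0, \<dots>, x (n - 1)\<close>. The set \<open>S\<close> is always \<open>space M\<close>.
\<close>

abbreviation power_measure :: "'a measure \<Rightarrow> nat \<Rightarrow> (nat \<Rightarrow> 'a) measure" where
  "power_measure M n \<equiv> Pi\<^sub>M {..<n} (\<lambda>_. M)"

definition delete_coord :: "nat \<Rightarrow> nat \<Rightarrow> (nat \<Rightarrow> 'a) \<Rightarrow> (nat \<Rightarrow> 'a)" where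
  "delete_coord n i x = (\<lambda>j\<in>{..<n - 1}. if j < i then x j else x (Suc j))"

text \<open>
  The diameter is taken in \<^typ>\<open>ereal\<close> so that unbounded spaces get diameter \<open>\<infinity>\<close>.
\<close>

definition diam :: "'b set \<Rightarrow> ('b \<Rightarrow> 'b \<Rightarrow> real) \<Rightarrow> ereal" where
  "diam X d = (SUP x\<in>X. SUP y\<in>X. ereal (d x y))"

definition Lip :: "'b set \<Rightarrow> ('b \<Rightarrow> 'b \<Rightarrow> real) \<Rightarrow> ('b \<Rightarrow> real) set" where
  "Lip X d = {g. (\<forall>x\<in>X. 0 \<le> g x \<and> ereal (g x) \<le> diam X d) \<and>
                 (\<forall>x\<in>X. \<forall>y\<in>X. \<bar>g x - g y\<bar> \<le> d x y)}"

text \<open>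
  If \<open>x\<close> is extensional on \<open>{..<n}\<close>, then \<open>case_nat t x\<close> is the point
  \<open>(t, x 0, \<dots>, x (n - 1))\<close>, extensional on \<open>{..<Suc n}\<close>.
\<close>

definition marginal :: "'a measure \<Rightarrow> ((nat \<Rightarrow> 'a) \<Rightarrow> real) \<Rightarrow> (nat \<Rightarrow> 'a) \<Rightarrow> real" where
  "marginal M f x = (\<integral>t. f (case_nat t x) \<partial>M)"

primrec Psi :: "'a measure \<Rightarrow> nat \<Rightarrow> ((nat \<Rightarrow> 'a) \<Rightarrow> real) \<Rightarrow> real" where
  "Psi M 0 f = 0"
| "Psi M (Suc n) f =
     (\<integral>x. max (f x) 0 \<partial>power_measure M (Suc n)) + Psi M n (marginal M f)"

text \<open>
  In (ii), the product formula on boxes is stated explicitly because \<^const>\<open>Pi\<^sub>M\<close> satisfies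
  it automatically only for sigma-finite factors. In (iii), the integrability clause says that
  the integrals under the supremum exist; without it, \<^const>\<open>lebesgue_integral\<close> would silently
  return 0.
\<close>

definition Psi_dominated ::
    "'a measure \<Rightarrow> (nat \<Rightarrow> (nat \<Rightarrow> 'a) \<Rightarrow> (nat \<Rightarrow> 'a) \<Rightarrow> real) \<Rightarrow> bool" where
  "Psi_dominated M \<rho> \<longleftrightarrow>
     (\<forall>n\<ge>1. Metric_space (space (power_measure M n)) (\<rho> n)) \<and>
     \<comment> \<open>(i)\<close>
     (\<forall>n\<ge>2. \<forall>i<n. \<forall>x\<in>space (power_measure M n). \<forall>y\<in>space (power_measure M n).
        x i = y i \<longrightarrow> \<rho> n x y = \<rho> (n - 1) (delete_coord n i x) (delete_coord n i y)) \<and>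
     \<comment> \<open>(ii)\<close>
     (\<forall>n\<ge>1.
        sets (power_measure M n) =
          sigma_sets (space (power_measure M n))
            {U. openin (Metric_space.mtopology (space (power_measure M n)) (\<rho> n)) U} \<and>
        (\<forall>A. (\<forall>i<n. A i \<in> sets M) \<longrightarrow>
           emeasure (power_measure M n) (Pi\<^sub>E {..<n} A) = (\<Prod>i<n. emeasure M (A i)))) \<and>
     \<comment> \<open>(iii)\<close>
     (\<forall>n\<ge>1. \<forall>f. integrable (power_measure M n) f \<longrightarrow>
        (\<forall>g\<in>Lip (space (power_measure M n)) (\<rho> n).
           integrable (power_measure M n) (\<lambda>x. f x * g x)) \<and>
        (SUP g\<in>Lip (space (power_measure M n)) (\<rho> n).
           ereal (\<integral>x. f x * g x \<partial>power_measure M n)) \<le> ereal (Psi M n f))"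

text \<open>
  Meant for \<open>n \<ge> 1\<close> and \<open>1 \<le> p \<le> \<infinity>\<close>; for \<open>n = 0\<close>, \<open>p = \<infinity>\<close> the maximum is over the empty set.
\<close>

definition lp_norm :: "ereal \<Rightarrow> nat \<Rightarrow> (nat \<Rightarrow> real) \<Rightarrow> real" where
  "lp_norm p n v =
     (if p = \<infinity> then Max ((\<lambda>i. \<bar>v i\<bar>) ` {..<n})
      else (\<Sum>i<n. \<bar>v i\<bar> powr real_of_ereal p) powr (1 / real_of_ereal p))"

end

theory Submission
  imports Defs
begin

text \<open>
  The \<open>\<ell>\<^sub>p\<close> norm enters the domination inequality only through
  \<open>\<parallel>v\<parallel>\<^sub>p \<le> \<parallel>v\<parallel>\<^sub>1\<close> (\<open>lp_norm_le_sum\<close>). It makes every function that is Lipschitz for the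
  \<open>\<ell>\<^sub>p\<close> metric Lipschitz for the \<open>\<ell>\<^sub>1\<close> metric and bounds the diameter of the \<open>n\<close>-dimensional cube
  by \<open>n\<close>. So it is enough to show \<open>\<integral> f g \<le> \<Psi>\<^sub>n(f)\<close> for \<open>\<ell>\<^sub>1\<close>-Lipschitz \<open>g\<close> with values in \<open>[0, n]\<close>.

  This goes by induction on the dimension (\<open>integral_mult_l1_Lipschitz_le_Psi\<close>). In the first
  coordinate \<open>t\<close> alone, \<open>g\<close> stays within \<open>1/2\<close> of its value at the midpoint \<open>t = 1/2\<close>. Hence,
  with \<open>h(y)\<close> the value of \<open>g(1/2, y) - 1/2\<close> clamped to \<open>[0, n - 1]\<close>, the difference
  \<open>g(t, y) - h(y)\<close> lies in \<open>[0, 1]\<close>. Splitting \<open>g = (g - h) + h\<close>, the first part contributes at most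
  \<open>\<integral> (f)\<^sub>+\<close>, and by Fubini the second contributes \<open>\<integral> (\<pi> f) h\<close>. Clamping preserves the Lipschitz
  property, so the induction hypothesis bounds the latter by \<open>\<Psi>\<^sub>n\<^sub>-\<^sub>1(\<pi> f)\<close>. The sum of the two
  bounds is \<open>\<Psi>\<^sub>n(f)\<close>.

  The Borel condition holds because \<open>max\<^sub>i \<bar>v\<^sub>i\<bar> \<le> \<parallel>v\<parallel>\<^sub>p \<le> \<parallel>v\<parallel>\<^sub>1\<close> determines the topology:
  coordinates are continuous, and open sets are countable unions of measurable \<open>\<ell>\<^sub>1\<close> balls with
  rational centres and radii (\<open>sets_power_measure_eq_metric_borel\<close>). The metric axioms rest on
  Minkowski's inequality.
\<close>

section \<open>The \<open>\<ell>\<^sub>p\<close> norm on finite sequences\<close>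

text \<open>
  On the open half-line this is \<open>powr_convex\<close>; the endpoint \<open>0\<close>, which norms do hit, follows from
  \<open>u\<^sup>q \<le> u\<close> on \<open>[0, 1]\<close>.
\<close>

lemma powr_convex_nonneg:
  fixes a b q s t :: real
  assumes "1 \<le> q" "0 \<le> a" "0 \<le> b" "0 \<le> s" "0 \<le> t" "s + t = 1"
  shows "(s * a + t * b) powr q \<le> s * a powr q + t * b powr q"
proof -
  have scale: "(u * c) powr q \<le> u * c powr q" if "0 \<le> u" "u \<le> 1" "0 \<le> c" for u c :: real
  proof -
    have "u powr q \<le> u"
      using powr_mono'[of 1 q u] that assms(1) by simp
    then show ?thesis
      using that by (simp add: powr_mult mult_right_mono)
  qed
  consider "a = 0" | "b = 0" | "0 < a" "0 < b"
    using assms by linarith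
  then show ?thesis
  proof cases
    case 3
    have "(\<lambda>x. x powr q) ((1 - t) *\<^sub>R a + t *\<^sub>R b) \<le> (1 - t) * a powr q + t * b powr q"
      by (rule convex_onD[OF powr_convex]) (use assms 3 in auto)
    moreover have "s = 1 - t"
      using assms by simp
    ultimately show ?thesis
      by simp
  qed (use assms scale in auto)
qed

text \<open>
  With \<open>A\<close> and \<open>B\<close> the two norms and \<open>C = A + B\<close>, the number \<open>(\<bar>v\<^sub>i\<bar> + \<bar>w\<^sub>i\<bar>) / C\<close> is the convex
  combination, with weights \<open>A / C\<close> and \<open>B / C\<close>, of the normalised entries \<open>\<bar>v\<^sub>i\<bar> / A\<close> and
  \<open>\<bar>w\<^sub>i\<bar> / B\<close>. Convexity of the power function then gives the inequality term by term, because the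
  \<open>q\<close>-th powers of the normalised entries sum to \<open>1\<close>.
\<close>

lemma sum_powr_root_minkowski:
  fixes v w :: "'a \<Rightarrow> real"
  assumes "finite I" and q: "1 \<le> q"
  shows "(\<Sum>i\<in>I. \<bar>v i + w i\<bar> powr q) powr (1 / q)
    \<le> (\<Sum>i\<in>I. \<bar>v i\<bar> powr q) powr (1 / q) + (\<Sum>i\<in>I. \<bar>w i\<bar> powr q) powr (1 / q)"
proof -
  define N where "N = (\<lambda>u. (\<Sum>i\<in>I. \<bar>u i\<bar> powr q) powr (1 / q))" for u :: "'a \<Rightarrow> real"
  have N_powr: "N u powr q = (\<Sum>i\<in>I. \<bar>u i\<bar> powr q)" for u
    using q by (simp add: N_def powr_powr sum_nonneg)
  have N_nonneg: "0 \<le> N u" for u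
    by (simp add: N_def)
  have N_0: "\<forall>i\<in>I. u i = 0" if "N u = 0" for u
    using N_powr[of u] that q \<open>finite I\<close> by (simp add: sum_nonneg_eq_0_iff)
  consider "N v = 0" | "N w = 0" | "0 < N v" "0 < N w"
    using N_nonneg[of v] N_nonneg[of w] by linarith
  then have "N (\<lambda>i. v i + w i) \<le> N v + N w"
  proof cases
    case 1
    then have "N (\<lambda>i. v i + w i) = N w"
      using N_0[OF 1] by (simp add: N_def)
    then show ?thesis
      using N_nonneg[of v] by simp
  next
    case 2
    then have "N (\<lambda>i. v i + w i) = N v"
      using N_0[OF 2] by (simp add: N_def)
    then show ?thesis
      using N_nonneg[of w] by simp
  next
    case 3
    define A B C where "A = N v" and "B = N w" and "C = A + B"
    have pos: "0 < A" "0 < B" "0 < C"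
      using 3 by (auto simp: A_def B_def C_def)
    have bound: "\<bar>v i + w i\<bar> powr q
        \<le> C powr q * (A / C * (\<bar>v i\<bar> powr q / A powr q) + B / C * (\<bar>w i\<bar> powr q / B powr q))" for i
    proof -
      have "\<bar>v i + w i\<bar> powr q \<le> (C * (A / C * (\<bar>v i\<bar> / A) + B / C * (\<bar>w i\<bar> / B))) powr q"
      proof (rule powr_mono2)
        have "C * (A / C * (\<bar>v i\<bar> / A) + B / C * (\<bar>w i\<bar> / B)) = \<bar>v i\<bar> + \<bar>w i\<bar>"
          using pos by (simp add: distrib_left)
        then show "\<bar>v i + w i\<bar> \<le> C * (A / C * (\<bar>v i\<bar> / A) + B / C * (\<bar>w i\<bar> / B))"
          using abs_triangle_ineq[of "v i" "w i"] by simp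
      qed (use q in auto)
      also have "\<dots> = C powr q * (A / C * (\<bar>v i\<bar> / A) + B / C * (\<bar>w i\<bar> / B)) powr q"
        using pos by (simp add: powr_mult)
      also have "\<dots> \<le> C powr q * (A / C * (\<bar>v i\<bar> / A) powr q + B / C * (\<bar>w i\<bar> / B) powr q)"
        using pos q
        by (intro mult_left_mono powr_convex_nonneg) (auto simp: C_def add_divide_distrib[symmetric])
      finally show ?thesis
        using pos by (simp add: powr_divide)
    qed
    have "N (\<lambda>i. v i + w i) powr q
        \<le> (\<Sum>i\<in>I. C powr q * (A / C * (\<bar>v i\<bar> powr q / A powr q) + B / C * (\<bar>w i\<bar> powr q / B powr q)))"
      unfolding N_powr by (intro sum_mono bound)
    also have "\<dots> = C powr q * (A / C * ((\<Sum>i\<in>I. \<bar>v i\<bar> powr q) / A powr q)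
        + B / C * ((\<Sum>i\<in>I. \<bar>w i\<bar> powr q) / B powr q))"
      by (simp only: sum_distrib_left sum.distrib sum_divide_distrib distrib_left)
    also have "\<dots> = C powr q * (A / C + B / C)"
      using pos by (simp add: N_powr[symmetric] A_def[symmetric] B_def[symmetric])
    also have "\<dots> = C powr q"
      using pos by (simp add: C_def add_divide_distrib[symmetric])
    finally have "N (\<lambda>i. v i + w i) powr q \<le> C powr q" .
    then have "N (\<lambda>i. v i + w i) \<le> C"
      using powr_less_mono2[of q C "N (\<lambda>i. v i + w i)"] pos q by linarith
    then show ?thesis
      by (simp add: A_def B_def C_def)
  qed
  then show ?thesis
    by (simp add: N_def)
qed

lemma lp_norm_cases:
  fixes p :: ereal
  assumes "1 \<le> p"
  obtains (infinite) "p = \<infinity>" "\<And>n v. lp_norm p n v = Max ((\<lambda>i. \<bar>v i\<bar>) ` {..<n})"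
  | (finite) q where "1 \<le> q"
    "\<And>n v. lp_norm p n v = (\<Sum>i<n. \<bar>v i\<bar> powr q) powr (1 / q)"
proof (cases p)
  case (real r)
  then show ?thesis
    using assms by (intro finite[of r]) (auto simp: lp_norm_def)
qed (use assms infinite in \<open>auto simp: lp_norm_def\<close>)

lemma lp_norm_minus_commute: "lp_norm p n (\<lambda>i. x i - y i) = lp_norm p n (\<lambda>i. y i - x i)"
  by (simp add: lp_norm_def abs_minus_commute)

lemma abs_le_lp_norm:
  assumes "1 \<le> p" and "i < n"
  shows "\<bar>v i\<bar> \<le> lp_norm p n v"
  using \<open>1 \<le> p\<close>
proof (cases rule: lp_norm_cases)
  case infinite
  then show ?thesis
    using \<open>i < n\<close> by (auto intro!: Max_ge)
next
  case (finite q)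
  have "\<bar>v i\<bar> = (\<bar>v i\<bar> powr q) powr (1 / q)"
    using finite(1) by (simp add: powr_powr)
  also have "\<dots> \<le> (\<Sum>i<n. \<bar>v i\<bar> powr q) powr (1 / q)"
    using \<open>i < n\<close> finite(1) by (intro powr_mono2 member_le_sum) auto
  finally show ?thesis
    by (simp add: finite(2))
qed

lemma lp_norm_nonneg:
  assumes "1 \<le> p" and "1 \<le> n"
  shows "0 \<le> lp_norm p n v"
  using abs_le_lp_norm[of p 0 n v] assms by linarith

text \<open>
  For finite \<open>q\<close>, dividing by the \<open>\<ell>\<^sub>1\<close> norm \<open>S\<close> puts all entries into \<open>[0, 1]\<close>, where taking
  \<open>q\<close>-th powers only decreases them.
\<close>

lemma lp_norm_le_sum:
  assumes "1 \<le> p" and "1 \<le> n"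
  shows "lp_norm p n v \<le> (\<Sum>i<n. \<bar>v i\<bar>)"
  using \<open>1 \<le> p\<close>
proof (cases rule: lp_norm_cases)
  case infinite
  have "\<bar>v i\<bar> \<le> (\<Sum>i<n. \<bar>v i\<bar>)" if "i < n" for i
    by (intro member_le_sum) (use that in auto)
  then show ?thesis
    using \<open>1 \<le> n\<close> by (auto simp: infinite(2) lessThan_empty_iff)
next
  case (finite q)
  define S where "S = (\<Sum>i<n. \<bar>v i\<bar>)"
  have S_ge: "\<bar>v i\<bar> \<le> S" if "i < n" for i
    unfolding S_def by (intro member_le_sum) (use that in auto)
  have "0 \<le> S"
    by (simp add: S_def sum_nonneg)
  have "(\<Sum>i<n. \<bar>v i\<bar> powr q) \<le> S powr q"
  proof (cases "S = 0")
    case False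
    then have "0 < S"
      using \<open>0 \<le> S\<close> by simp
    have "\<bar>v i\<bar> powr q \<le> \<bar>v i\<bar> / S * S powr q" if "i < n" for i
    proof -
      have "(\<bar>v i\<bar> / S) powr q \<le> (\<bar>v i\<bar> / S) powr 1"
        using finite(1) S_ge[OF that] \<open>0 < S\<close> by (intro powr_mono') auto
      then show ?thesis
        using \<open>0 < S\<close> by (simp add: powr_divide field_simps)
    qed
    then have "(\<Sum>i<n. \<bar>v i\<bar> powr q) \<le> (\<Sum>i<n. \<bar>v i\<bar> / S * S powr q)"
      by (intro sum_mono) simp
    also have "\<dots> = S powr q"
      using \<open>0 < S\<close> by (simp add: sum_distrib_right[symmetric] sum_divide_distrib[symmetric] S_def[symmetric])
    finally show ?thesis .
  qed (use S_ge in auto)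
  then have "(\<Sum>i<n. \<bar>v i\<bar> powr q) powr (1 / q) \<le> (S powr q) powr (1 / q)"
    using finite(1) by (intro powr_mono2) (auto simp: sum_nonneg)
  also have "\<dots> = S"
    using finite(1) \<open>0 \<le> S\<close> by (simp add: powr_powr)
  finally show ?thesis
    by (simp add: finite(2) S_def)
qed

lemma lp_norm_triangle:
  assumes "1 \<le> p" and "1 \<le> n"
  shows "lp_norm p n (\<lambda>i. v i + w i) \<le> lp_norm p n v + lp_norm p n w"
  using \<open>1 \<le> p\<close>
proof (cases rule: lp_norm_cases)
  case infinite
  have "\<bar>v i + w i\<bar> \<le> lp_norm p n v + lp_norm p n w" if "i < n" for i
    using abs_le_lp_norm[OF \<open>1 \<le> p\<close> that, of v] abs_le_lp_norm[OF \<open>1 \<le> p\<close> that, of w] by linarith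
  then show ?thesis
    using \<open>1 \<le> n\<close> by (subst infinite(2)) (auto simp: lessThan_empty_iff)
qed (simp add: sum_powr_root_minkowski)

lemma Metric_space_lp_norm:
  assumes "1 \<le> p" and "1 \<le> n" and "X \<subseteq> extensional {..<n}"
  shows "Metric_space X (\<lambda>x y. lp_norm p n (\<lambda>i. x i - y i))"
proof
  fix x y z :: "nat \<Rightarrow> real"
  show "0 \<le> lp_norm p n (\<lambda>i. x i - y i)"
    by (rule lp_norm_nonneg[OF assms(1,2)])
  show "lp_norm p n (\<lambda>i. x i - y i) = lp_norm p n (\<lambda>i. y i - x i)"
    by (rule lp_norm_minus_commute)
  show "lp_norm p n (\<lambda>i. x i - z i)
      \<le> lp_norm p n (\<lambda>i. x i - y i) + lp_norm p n (\<lambda>i. y i - z i)"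
    using lp_norm_triangle[OF assms(1,2), of "\<lambda>i. x i - y i" "\<lambda>i. y i - z i"] by simp
  assume "x \<in> X" "y \<in> X"
  show "lp_norm p n (\<lambda>i. x i - y i) = 0 \<longleftrightarrow> x = y"
  proof
    assume "lp_norm p n (\<lambda>i. x i - y i) = 0"
    then have "x i = y i" if "i < n" for i
      using abs_le_lp_norm[OF assms(1) that, of "\<lambda>i. x i - y i"] by simp
    then show "x = y"
      using \<open>x \<in> X\<close> \<open>y \<in> X\<close> assms(3) by (intro extensionalityI[of x "{..<n}" y]) auto
  next
    assume "x = y"
    then show "lp_norm p n (\<lambda>i. x i - y i) = 0"
      using lp_norm_le_sum[OF assms(1,2), of "\<lambda>i. x i - y i"]
        lp_norm_nonneg[OF assms(1,2), of "\<lambda>i. x i - y i"] by simp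
  qed
qed

text \<open>
  The deleted coordinate contributes \<open>0\<close> to the sum or to the maximum. The bound \<open>2 \<le> n\<close> keeps
  the remaining maximum over a nonempty set.
\<close>

lemma lp_norm_delete_coord:
  assumes "1 \<le> p" and "2 \<le> n" and "i < n" and "x i = y i"
  shows "lp_norm p n (\<lambda>j. x j - y j)
    = lp_norm p (n - 1) (\<lambda>j. delete_coord n i x j - delete_coord n i y j)"
proof -
  \<comment> \<open>\<open>s\<close> enumerates the surviving coordinates in increasing order.\<close>
  define s where "s = (\<lambda>j. if j < i then j else Suc j)"
  have s: "bij_betw s {..<n - 1} ({..<n} - {i})"
    unfolding bij_betw_def
  proof
    show "inj_on s {..<n - 1}"
      by (auto simp: inj_on_def s_def split: if_splits)
    show "s ` {..<n - 1} = {..<n} - {i}"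
    proof (intro equalityI subsetI)
      fix j assume "j \<in> {..<n} - {i}"
      then show "j \<in> s ` {..<n - 1}"
        using \<open>i < n\<close> by (intro image_eqI[of _ _ "if j < i then j else j - 1"]) (auto simp: s_def)
    qed (use \<open>i < n\<close> in \<open>auto simp: s_def\<close>)
  qed
  have del: "delete_coord n i x j - delete_coord n i y j = x (s j) - y (s j)" if "j < n - 1" for j
    using that by (simp add: delete_coord_def s_def)
  show ?thesis
    using \<open>1 \<le> p\<close>
  proof (cases rule: lp_norm_cases)
    case infinite
    let ?f = "\<lambda>j. \<bar>x j - y j\<bar>"
    have "{..<n} = insert i (s ` {..<n - 1})"
      using s \<open>i < n\<close> by (auto simp: bij_betw_def)
    then have "?f ` {..<n} = insert (?f i) (?f ` s ` {..<n - 1})"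
      by auto
    moreover have "?f ` s ` {..<n - 1} \<noteq> {}"
      using \<open>2 \<le> n\<close> by (auto simp: lessThan_empty_iff)
    ultimately have "Max (?f ` {..<n}) = max (?f i) (Max (?f ` s ` {..<n - 1}))"
      by simp
    also have "\<dots> = Max (?f ` s ` {..<n - 1})"
      using \<open>2 \<le> n\<close> \<open>x i = y i\<close> by (auto simp: max_def not_le lessThan_empty_iff)
    also have "?f ` s ` {..<n - 1} = (\<lambda>j. \<bar>delete_coord n i x j - delete_coord n i y j\<bar>) ` {..<n - 1}"
      unfolding image_image by (intro image_cong) (auto simp: del)
    finally show ?thesis
      by (simp add: infinite(2))
  next
    case (finite q)
    have "(\<Sum>j<n. \<bar>x j - y j\<bar> powr q) = (\<Sum>j\<in>{..<n} - {i}. \<bar>x j - y j\<bar> powr q)"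
      using \<open>i < n\<close> \<open>x i = y i\<close> by (subst sum.remove[of _ i]) auto
    also have "\<dots> = (\<Sum>j<n - 1. \<bar>delete_coord n i x j - delete_coord n i y j\<bar> powr q)"
      by (subst sum.reindex_bij_betw[OF s, symmetric]) (auto simp: del)
    finally show ?thesis
      by (simp add: finite(2))
  qed
qed

section \<open>Open sets of the cube and the product \<open>\<sigma>\<close>-algebra\<close>

lemma measurable_coordinate_real:
  fixes M :: "real measure"
  assumes "sets M = sets (restrict_space borel S)" and "i < n"
  shows "(\<lambda>x. x i) \<in> borel_measurable (power_measure M n)"
proof -
  have "(\<lambda>x. x) \<in> M \<rightarrow>\<^sub>M borel"
    unfolding measurable_cong_sets[OF assms(1) refl]
    by (intro measurable_restrict_space1) simp
  with measurable_component_singleton[of i "{..<n}" "\<lambda>_. M"] show ?thesis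
    using \<open>i < n\<close> by (auto intro: measurable_compose)
qed

text \<open>
  Every \<open>\<ell>\<^sub>1\<close>-open set is the union of the countably many \<open>\<ell>\<^sub>1\<close> balls with rational centre and
  radius that it contains, and such balls are measurable because coordinates are. The centres
  range over all rational points rather than those of the cube: then every point of the cube has
  centres near it, even if \<open>S\<close> contains no rational number.
\<close>

lemma sets_PiM_of_l1_open:
  fixes M :: "real measure"
  assumes M: "sets M = sets (restrict_space borel S)"
    and sub: "U \<subseteq> space (power_measure M n)"
    and op: "\<And>x. x \<in> U \<Longrightarrow> \<exists>e>0. \<forall>y\<in>space (power_measure M n). (\<Sum>i<n. \<bar>x i - y i\<bar>) < e \<longrightarrow> y \<in> U"
  shows "U \<in> sets (power_measure M n)"
proof -
  let ?X = "space (power_measure M n)"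
  note [measurable] = measurable_coordinate_real[OF M]
  define B where "B = (\<lambda>(q, r). {x \<in> ?X. (\<Sum>i<n. \<bar>x i - q i\<bar>) < r})"
  define D where "D = {c \<in> ({..<n} \<rightarrow>\<^sub>E \<rat>) \<times> \<rat>. B c \<subseteq> U}"
  have "countable D"
    unfolding D_def by (rule countable_subset[of _ "({..<n} \<rightarrow>\<^sub>E \<rat>) \<times> \<rat>"])
      (auto intro!: countable_PiE countable_rat)
  have B_sets: "B c \<in> sets (power_measure M n)" for c
    unfolding B_def by (cases c) simp
  have "U = \<Union> (B ` D)"
  proof (intro equalityI subsetI)
    fix x assume "x \<in> U"
    then obtain e where e: "0 < e" "\<And>y. y \<in> ?X \<Longrightarrow> (\<Sum>i<n. \<bar>x i - y i\<bar>) < e \<Longrightarrow> y \<in> U"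
      using op by blast
    define \<delta> where "\<delta> = e / (2 * (real n + 1))"
    have \<delta>: "0 < \<delta>" "real n * \<delta> < e / 2"
      using e(1) by (auto simp: \<delta>_def field_simps)
    have "\<forall>i. \<exists>a\<in>\<rat>. x i < a \<and> a < x i + \<delta>"
      using \<delta> by (intro allI Rats_dense_in_real) simp
    then obtain a where a: "\<And>i. a i \<in> \<rat>" "\<And>i. x i < a i" "\<And>i. a i < x i + \<delta>"
      by metis
    define q where "q = restrict a {..<n}"
    have "(\<Sum>i<n. \<bar>x i - q i\<bar>) \<le> (\<Sum>i<n. \<delta>)"
      using a(2,3) by (intro sum_mono) (auto simp: q_def abs_le_iff less_imp_le algebra_simps)
    with \<delta> have "(\<Sum>i<n. \<bar>x i - q i\<bar>) < e / 2"
      by simp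
    then obtain r where r: "r \<in> \<rat>" "(\<Sum>i<n. \<bar>x i - q i\<bar>) < r" "r < e / 2"
      using Rats_dense_in_real by blast
    have "B (q, r) \<subseteq> U"
    proof
      fix y assume "y \<in> B (q, r)"
      then have y: "y \<in> ?X" "(\<Sum>i<n. \<bar>y i - q i\<bar>) < r"
        by (auto simp: B_def)
      have "(\<Sum>i<n. \<bar>x i - y i\<bar>) \<le> (\<Sum>i<n. \<bar>x i - q i\<bar> + \<bar>y i - q i\<bar>)"
        by (intro sum_mono) linarith
      also have "\<dots> < e"
        using r y by (simp add: sum.distrib)
      finally show "y \<in> U"
        using e(2) y(1) by blast
    qed
    moreover have "(q, r) \<in> ({..<n} \<rightarrow>\<^sub>E \<rat>) \<times> \<rat>"
      using a(1) r(1) by (auto simp: q_def)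
    moreover have "x \<in> B (q, r)"
      using r \<open>x \<in> U\<close> sub by (auto simp: B_def)
    ultimately show "x \<in> \<Union> (B ` D)"
      unfolding D_def by blast
  qed (auto simp: D_def)
  also have "\<dots> \<in> sets (power_measure M n)"
    using \<open>countable D\<close> B_sets by (intro sets.countable_UN') auto
  finally show ?thesis .
qed

lemma borel_measurable_l1_Lipschitz:
  fixes M :: "real measure" and g :: "(nat \<Rightarrow> real) \<Rightarrow> real"
  assumes M: "sets M = sets (restrict_space borel S)"
    and g: "\<And>x y. x \<in> space (power_measure M n) \<Longrightarrow> y \<in> space (power_measure M n) \<Longrightarrow>
      \<bar>g x - g y\<bar> \<le> (\<Sum>i<n. \<bar>x i - y i\<bar>)"
  shows "g \<in> borel_measurable (power_measure M n)"
proof (rule borel_measurableI)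
  fix T :: "real set" assume "open T"
  show "g -` T \<inter> space (power_measure M n) \<in> sets (power_measure M n)"
  proof (rule sets_PiM_of_l1_open[OF M])
    fix x assume x: "x \<in> g -` T \<inter> space (power_measure M n)"
    then obtain e where e: "0 < e" "\<And>z. dist z (g x) < e \<Longrightarrow> z \<in> T"
      using \<open>open T\<close> by (auto simp: open_dist)
    have "g y \<in> T" if y: "y \<in> space (power_measure M n)" "(\<Sum>i<n. \<bar>x i - y i\<bar>) < e" for y
    proof (rule e(2))
      show "dist (g y) (g x) < e"
        using g[of x y] x y by (simp add: dist_real_def abs_minus_commute)
    qed
    then show "\<exists>e>0. \<forall>y\<in>space (power_measure M n).
        (\<Sum>i<n. \<bar>x i - y i\<bar>) < e \<longrightarrow> y \<in> g -` T \<inter> space (power_measure M n)"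
      using e(1) by blast
  qed simp
qed

text \<open>
  The lower bound on \<open>d\<close> makes coordinates continuous, hence the product \<open>\<sigma>\<close>-algebra is contained in
  the Borel one; the upper bound makes \<open>d\<close>-open sets \<open>\<ell>\<^sub>1\<close>-open, which gives the other inclusion.
\<close>

lemma sets_power_measure_eq_metric_borel:
  fixes M :: "real measure"
  assumes M: "sets M = sets (restrict_space borel S)"
    and metric: "Metric_space (space (power_measure M n)) d"
    and coord: "\<And>x y i. i < n \<Longrightarrow> \<bar>x i - y i\<bar> \<le> d x y"
    and l1: "\<And>x y. d x y \<le> (\<Sum>i<n. \<bar>x i - y i\<bar>)"
  shows "sets (power_measure M n) = sigma_sets (space (power_measure M n))
    {U. openin (Metric_space.mtopology (space (power_measure M n)) d) U}"
proof -
  let ?X = "space (power_measure M n)"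
  interpret Metric_space ?X d
    by (rule metric)
  define N where "N = sigma ?X {U. openin mtopology U}"
  have opens: "{U. openin mtopology U} \<subseteq> Pow ?X"
    using openin_mtopology by auto
  have sets_N: "sets N = sigma_sets ?X {U. openin mtopology U}" and space_N: "space N = ?X"
    using opens by (simp_all add: N_def)
  have "sets N \<subseteq> sets (power_measure M n)"
    unfolding sets_N
  proof (rule sets.sigma_sets_subset)
    show "{U. openin mtopology U} \<subseteq> sets (power_measure M n)"
    proof
      fix U assume "U \<in> {U. openin mtopology U}"
      then have U: "U \<subseteq> ?X" "\<And>x. x \<in> U \<Longrightarrow> \<exists>r>0. mball x r \<subseteq> U"
        by (auto simp: openin_mtopology)
      show "U \<in> sets (power_measure M n)"
      proof (rule sets_PiM_of_l1_open[OF M U(1)])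
        fix x assume "x \<in> U"
        then obtain r where "0 < r" "mball x r \<subseteq> U"
          using U(2) by blast
        moreover have "y \<in> mball x r" if "y \<in> ?X" "(\<Sum>i<n. \<bar>x i - y i\<bar>) < r" for y
          using that \<open>x \<in> U\<close> U(1) l1[of x y] by auto
        ultimately show "\<exists>e>0. \<forall>y\<in>?X. (\<Sum>i<n. \<bar>x i - y i\<bar>) < e \<longrightarrow> y \<in> U"
          by blast
      qed
    qed
  qed
  moreover have "sets (power_measure M n) \<subseteq> sets N"
  proof -
    have "(\<lambda>x. x) \<in> N \<rightarrow>\<^sub>M power_measure M n"
    proof (rule measurable_PiM_single)
      show "(\<lambda>x. x) \<in> space N \<rightarrow> {..<n} \<rightarrow>\<^sub>E space M"
        by (auto simp: space_N space_PiM)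
      fix A i assume i: "i \<in> {..<n}" and A: "A \<in> sets M"
      have coord_borel: "(\<lambda>x. x i) \<in> borel_measurable N"
      proof (rule borel_measurableI)
        fix T :: "real set" assume "open T"
        have "openin mtopology ((\<lambda>x. x i) -` T \<inter> ?X)"
          unfolding openin_mtopology
        proof (intro conjI allI impI)
          fix x assume x: "x \<in> (\<lambda>x. x i) -` T \<inter> ?X"
          then obtain e where e: "0 < e" "\<And>z. dist z (x i) < e \<Longrightarrow> z \<in> T"
            using \<open>open T\<close> by (auto simp: open_dist)
          have "mball x e \<subseteq> (\<lambda>x. x i) -` T \<inter> ?X"
          proof
            fix y assume y: "y \<in> mball x e"
            then have "dist (y i) (x i) < e"
              using coord[of i x y] i by (auto simp: dist_real_def abs_minus_commute)
            then show "y \<in> (\<lambda>x. x i) -` T \<inter> ?X"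
              using e(2) y by auto
          qed
          then show "\<exists>r>0. mball x r \<subseteq> (\<lambda>x. x i) -` T \<inter> ?X"
            using e(1) by blast
        qed simp
        then show "(\<lambda>x. x i) -` T \<inter> space N \<in> sets N"
          by (auto simp: sets_N space_N)
      qed
      obtain A' where A': "A' \<in> sets borel" "A = S \<inter> A'"
        using A unfolding M sets_restrict_space by auto
      have "space M = S"
        using sets_eq_imp_space_eq[OF M] by (simp add: space_restrict_space)
      then have "{x \<in> space N. x i \<in> A} = (\<lambda>x. x i) -` A' \<inter> space N"
        using i A' by (auto simp: space_N space_PiM)
      then show "{x \<in> space N. x i \<in> A} \<in> sets N"
        using measurable_sets[OF coord_borel A'(1)] by simp
    qed
    then show ?thesis
      using measurable_sets[of "\<lambda>x. x" N "power_measure M n"] sets.sets_into_space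
      by (force simp: space_N Int_absorb2)
  qed
  ultimately show ?thesis
    by (simp add: sets_N)
qed

section \<open>Integrating out the first coordinate\<close>

context sigma_finite_measure
begin

lemma product_sigma_finite_const: "product_sigma_finite (\<lambda>_. M)"
  by standard

lemma sigma_finite_power_measure: "sigma_finite_measure (power_measure M n)"
  using product_sigma_finite_const by (rule product_sigma_finite.sigma_finite) simp

lemma measurable_case_nat_power:
  "(\<lambda>(t, x). case_nat t x) \<in> M \<Otimes>\<^sub>M power_measure M n \<rightarrow>\<^sub>M power_measure M (Suc n)"
proof (rule measurable_PiM_single)
  show "(\<lambda>(t, x). case_nat t x) \<in> space (M \<Otimes>\<^sub>M power_measure M n) \<rightarrow> {..<Suc n} \<rightarrow>\<^sub>E space M"
  proof
    fix z assume "z \<in> space (M \<Otimes>\<^sub>M power_measure M n)"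
    then obtain t x where z: "z = (t, x)" "t \<in> space M" "x \<in> {..<n} \<rightarrow>\<^sub>E space M"
      by (auto simp: space_pair_measure space_PiM)
    have "case_nat t x i \<in> space M" if "i < Suc n" for i
      using that z by (cases i) (auto dest: PiE_mem)
    moreover have "case_nat t x i = undefined" if "\<not> i < Suc n" for i
      using that z by (cases i) (auto dest: PiE_arb)
    ultimately show "(case z of (t, x) \<Rightarrow> case_nat t x) \<in> {..<Suc n} \<rightarrow>\<^sub>E space M"
      unfolding z by (intro PiE_I) auto
  qed
  fix A i assume [measurable]: "A \<in> sets M" and "i \<in> {..<Suc n}"
  then show "{\<omega> \<in> space (M \<Otimes>\<^sub>M power_measure M n). (case \<omega> of (t, x) \<Rightarrow> case_nat t x) i \<in> A}
      \<in> sets (M \<Otimes>\<^sub>M power_measure M n)"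
    by (cases i) (auto simp: split_beta')
qed

text \<open>
  This identification of \<open>M \<otimes> M\<^sup>n\<close> with \<open>M\<^sup>n\<^sup>+\<^sup>1\<close> turns the recursion of \<^const>\<open>Psi\<close>, which peels off the
  first coordinate, into an application of Fubini's theorem.
\<close>

lemma distr_case_nat_power:
  "distr (M \<Otimes>\<^sub>M power_measure M n) (power_measure M (Suc n)) (\<lambda>(t, x). case_nat t x)
    = power_measure M (Suc n)"
proof (rule product_sigma_finite.PiM_eqI[OF product_sigma_finite_const])
  interpret P: sigma_finite_measure "power_measure M n"
    by (rule sigma_finite_power_measure)
  fix A :: "nat \<Rightarrow> 'a set" assume A: "\<And>i. i \<in> {..<Suc n} \<Longrightarrow> A i \<in> sets M"
  let ?N = "M \<Otimes>\<^sub>M power_measure M n"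
  have "(\<lambda>(t, x). case_nat t x) -` Pi\<^sub>E {..<Suc n} A \<inter> space ?N
      = A 0 \<times> Pi\<^sub>E {..<n} (\<lambda>i. A (Suc i))"
  proof (intro equalityI subsetI)
    fix z assume z: "z \<in> (\<lambda>(t, x). case_nat t x) -` Pi\<^sub>E {..<Suc n} A \<inter> space ?N"
    obtain t x where tx: "z = (t, x)"
      by fastforce
    have mem: "case_nat t x i \<in> A i" if "i < Suc n" for i
      using z that by (auto simp: tx)
    have "x i \<in> A (Suc i)" if "i < n" for i
      using mem[of "Suc i"] that by simp
    moreover have "x \<in> extensional {..<n}"
      using z by (auto simp: tx space_pair_measure space_PiM PiE_iff)
    ultimately show "z \<in> A 0 \<times> Pi\<^sub>E {..<n} (\<lambda>i. A (Suc i))"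
      using mem[of 0] by (auto simp: tx PiE_iff)
  next
    fix z assume z: "z \<in> A 0 \<times> Pi\<^sub>E {..<n} (\<lambda>i. A (Suc i))"
    obtain t x where tx: "z = (t, x)"
      by fastforce
    have "A i \<subseteq> space M" if "i < Suc n" for i
      using A that sets.sets_into_space by auto
    then show "z \<in> (\<lambda>(t, x). case_nat t x) -` Pi\<^sub>E {..<Suc n} A \<inter> space ?N"
      using z by (fastforce simp: tx space_pair_measure space_PiM PiE_iff extensional_def split: nat.split)
  qed
  then have "emeasure (distr ?N (power_measure M (Suc n)) (\<lambda>(t, x). case_nat t x)) (Pi\<^sub>E {..<Suc n} A)
      = emeasure ?N (A 0 \<times> Pi\<^sub>E {..<n} (\<lambda>i. A (Suc i)))"
    using A by (subst emeasure_distr[OF measurable_case_nat_power]) (auto intro!: sets_PiM_I_finite)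
  also have "\<dots> = emeasure M (A 0) * emeasure (power_measure M n) (Pi\<^sub>E {..<n} (\<lambda>i. A (Suc i)))"
    using A by (intro P.emeasure_pair_measure_Times sets_PiM_I_finite) auto
  also have "\<dots> = emeasure M (A 0) * (\<Prod>i<n. emeasure M (A (Suc i)))"
    using A by (subst product_sigma_finite.emeasure_PiM[OF product_sigma_finite_const]) auto
  also have "\<dots> = (\<Prod>i<Suc n. emeasure M (A i))"
    by (simp only: prod.lessThan_Suc_shift)
  finally show "emeasure (distr ?N (power_measure M (Suc n)) (\<lambda>(t, x). case_nat t x)) (Pi\<^sub>E {..<Suc n} A)
      = (\<Prod>i<Suc n. emeasure M (A i))" .
qed simp_all

lemma
  fixes f :: "(nat \<Rightarrow> 'a) \<Rightarrow> real"
  assumes f: "integrable (power_measure M (Suc n)) f"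
  shows integrable_case_nat_power:
      "integrable (M \<Otimes>\<^sub>M power_measure M n) (\<lambda>(t, x). f (case_nat t x))"
    and integral_case_nat_power:
      "(\<integral>x. f x \<partial>power_measure M (Suc n)) = (\<integral>(t, x). f (case_nat t x) \<partial>(M \<Otimes>\<^sub>M power_measure M n))"
proof -
  have eq: "(\<lambda>(t, x). f (case_nat t x)) = (\<lambda>z. f (case z of (t, x) \<Rightarrow> case_nat t x))"
    by (simp add: fun_eq_iff)
  show "integrable (M \<Otimes>\<^sub>M power_measure M n) (\<lambda>(t, x). f (case_nat t x))"
    unfolding eq
    by (rule integrable_distr[OF measurable_case_nat_power]) (simp add: distr_case_nat_power f)
  show "(\<integral>x. f x \<partial>power_measure M (Suc n)) = (\<integral>(t, x). f (case_nat t x) \<partial>(M \<Otimes>\<^sub>M power_measure M n))"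
    unfolding eq using f
    by (subst distr_case_nat_power[symmetric])
      (rule integral_distr[OF measurable_case_nat_power], simp)
qed

lemma integrable_marginal:
  assumes f: "integrable (power_measure M (Suc n)) f"
  shows "integrable (power_measure M n) (marginal M f)"
proof -
  interpret P: sigma_finite_measure "power_measure M n"
    by (rule sigma_finite_power_measure)
  interpret pair: pair_sigma_finite M "power_measure M n" ..
  show ?thesis
    using pair.integrable_snd[OF integrable_case_nat_power[OF f]] by (simp add: marginal_def[abs_def])
qed

lemma integral_marginal_mult:
  assumes f: "integrable (power_measure M (Suc n)) f"
    and int: "integrable (M \<Otimes>\<^sub>M power_measure M n) (\<lambda>(t, x). f (case_nat t x) * h x)"
  shows "(\<integral>(t, x). f (case_nat t x) * h x \<partial>(M \<Otimes>\<^sub>M power_measure M n))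
    = (\<integral>x. marginal M f x * h x \<partial>power_measure M n)"
proof -
  interpret P: sigma_finite_measure "power_measure M n"
    by (rule sigma_finite_power_measure)
  interpret pair: pair_sigma_finite M "power_measure M n" ..
  show ?thesis
    using pair.integral_snd[OF int] by (simp add: marginal_def)
qed

end

section \<open>The inequality for functions that are Lipschitz in the \<open>\<ell>\<^sub>1\<close> metric\<close>

lemma integrable_mult_bounded:
  fixes f g :: "'a \<Rightarrow> real"
  assumes "integrable M f" and "g \<in> borel_measurable M" and "\<And>x. x \<in> space M \<Longrightarrow> \<bar>g x\<bar> \<le> c"
  shows "integrable M (\<lambda>x. f x * g x)"
proof (rule Bochner_Integration.integrable_bound)
  show "integrable M (\<lambda>x. c * f x)"
    using assms(1) by simp
  show "AE x in M. norm (f x * g x) \<le> norm (c * f x)"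
  proof (rule AE_I2)
    fix x assume "x \<in> space M"
    then have "\<bar>g x\<bar> \<le> \<bar>c\<bar>"
      using assms(3)[of x] by linarith
    then show "norm (f x * g x) \<le> norm (c * f x)"
      by (simp add: abs_mult mult.commute[of "\<bar>f x\<bar>"] mult_right_mono)
  qed
qed (use assms in measurable)

lemma sigma_finite_restrict_lborel: "sigma_finite_measure (restrict_space lborel {0..1::real})"
  by (rule sigma_finite_measure_restrict_space) (auto simp: lborel.sigma_finite_measure_axioms)

text \<open>
  The bound \<open>n\<close> on \<open>g\<close>, rather than the diameter of any particular metric, is what the induction
  can maintain: removing a coordinate lowers it by exactly \<open>1\<close>, the oscillation in that coordinate.
  In dimension \<open>0\<close> it forces \<open>g = 0\<close>, which matches \<open>\<Psi>\<^sub>0 = 0\<close>.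
\<close>

lemma integral_mult_l1_Lipschitz_le_Psi:
  fixes M :: "real measure"
  defines "M \<equiv> restrict_space lborel {0..1}"
  assumes "integrable (power_measure M n) f"
    and "\<And>x. x \<in> space (power_measure M n) \<Longrightarrow> 0 \<le> g x \<and> g x \<le> real n"
    and "\<And>x y. x \<in> space (power_measure M n) \<Longrightarrow> y \<in> space (power_measure M n) \<Longrightarrow>
      \<bar>g x - g y\<bar> \<le> (\<Sum>i<n. \<bar>x i - y i\<bar>)"
  shows "(\<integral>x. f x * g x \<partial>power_measure M n) \<le> Psi M n f"
  using assms(2-)
proof (induction n arbitrary: f g)
  case 0
  have "(\<integral>x. f x * g x \<partial>power_measure M 0) = (\<integral>x. 0 \<partial>power_measure M 0)"
    by (intro Bochner_Integration.integral_cong refl) (use "0.prems"(2) in force)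
  then show ?case
    by simp
next
  case (Suc n)
  note f = Suc.prems(1) and g_range = Suc.prems(2) and g_lip = Suc.prems(3)
  have M_sets: "sets M = sets (restrict_space borel {0..1})"
    by (simp add: M_def sets_restrict_space)
  have M_space: "space M = {0..1}"
    by (simp add: M_def space_restrict_space)
  interpret sigma_finite_measure M
    unfolding M_def by (rule sigma_finite_restrict_lborel)
  let ?N = "M \<Otimes>\<^sub>M power_measure M n"
  define F where "F = (\<lambda>(t, x). f (case_nat t x))"
  define G where "G = (\<lambda>(t, x). g (case_nat t x))"
  \<comment> \<open>The shift by \<open>1/2\<close> puts \<open>g - h\<close> into \<open>[0, 1]\<close> before clamping; clamping to \<open>[0, n]\<close> keeps it
    there because \<open>g\<close> itself lies in \<open>[0, n + 1]\<close>.\<close>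
  define h where "h = (\<lambda>x. max 0 (min (real n) (g (case_nat (1/2) x) - 1/2)))"
  define H where "H = (\<lambda>(t::real, x). h x)"
  have cons: "case_nat t x \<in> space (power_measure M (Suc n))"
    if "t \<in> {0..1}" "x \<in> space (power_measure M n)" for t x
    using measurable_space[OF measurable_case_nat_power, of "(t, x)" n] that
    by (simp add: space_pair_measure M_space)

  have h_range: "0 \<le> h x \<and> h x \<le> real n" for x
    by (simp add: h_def)
  have h_lip: "\<bar>h x - h y\<bar> \<le> (\<Sum>i<n. \<bar>x i - y i\<bar>)"
    if "x \<in> space (power_measure M n)" "y \<in> space (power_measure M n)" for x y
  proof -
    have "\<bar>h x - h y\<bar> \<le> \<bar>g (case_nat (1/2) x) - g (case_nat (1/2) y)\<bar>"
      by (auto simp: h_def max_def min_def)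
    also have "\<dots> \<le> (\<Sum>i<n. \<bar>x i - y i\<bar>)"
      using g_lip[OF cons cons, of "1/2" x "1/2" y] that by (simp add: sum.lessThan_Suc_shift del: sum.lessThan_Suc)
    finally show ?thesis .
  qed
  have gap: "0 \<le> G z - H z \<and> G z - H z \<le> 1" if "z \<in> space ?N" for z
  proof -
    obtain t x where tx: "z = (t, x)"
      by fastforce
    then have z: "z = (t, x)" "t \<in> {0..1}" "x \<in> space (power_measure M n)"
      using that by (simp_all add: space_pair_measure M_space)
    have "\<bar>g (case_nat t x) - g (case_nat (1/2) x)\<bar> \<le> \<bar>t - 1/2\<bar>"
      using g_lip[OF cons cons, of t x "1/2" x] z by (simp add: sum.lessThan_Suc_shift del: sum.lessThan_Suc)
    also have "\<dots> \<le> 1/2"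
      using z(2) unfolding atLeastAtMost_iff by linarith
    finally have "\<bar>g (case_nat t x) - g (case_nat (1/2) x)\<bar> \<le> 1/2" .
    moreover have "0 \<le> g (case_nat t x)" "g (case_nat t x) \<le> real n + 1"
      using g_range[OF cons[OF z(2,3)]] by simp_all
    ultimately show ?thesis
      unfolding z(1) G_def H_def h_def prod.case by linarith
  qed

  have F_int: "integrable ?N F"
    unfolding F_def by (rule integrable_case_nat_power[OF f])
  have g_meas: "g \<in> borel_measurable (power_measure M (Suc n))"
    by (rule borel_measurable_l1_Lipschitz[OF M_sets g_lip])
  have [measurable]: "G \<in> borel_measurable ?N"
    using measurable_compose[OF measurable_case_nat_power g_meas] by (simp add: G_def split_beta')
  have [measurable]: "h \<in> borel_measurable (power_measure M n)"
    by (rule borel_measurable_l1_Lipschitz[OF M_sets h_lip])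
  have [measurable]: "H \<in> borel_measurable ?N"
    unfolding H_def by simp
  have FH_int: "integrable ?N (\<lambda>z. F z * H z)"
    by (rule integrable_mult_bounded[OF F_int, where c = "real n"])
      (use h_range in \<open>auto simp: H_def split_beta\<close>)
  have FGH_int: "integrable ?N (\<lambda>z. F z * (G z - H z))"
    by (rule integrable_mult_bounded[OF F_int, where c = 1]) (use gap in auto)
  have fg_int: "integrable (power_measure M (Suc n)) (\<lambda>x. f x * g x)"
    by (rule integrable_mult_bounded[OF f g_meas, where c = "real (Suc n)"]) (use g_range in auto)
  have f_pos: "integrable (power_measure M (Suc n)) (\<lambda>x. max (f x) 0)"
    using f by simp

  have "(\<integral>x. f x * g x \<partial>power_measure M (Suc n)) = (\<integral>z. F z * G z \<partial>?N)"
    using integral_case_nat_power[OF fg_int] by (simp add: F_def G_def split_beta')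
  also have "\<dots> = (\<integral>z. F z * (G z - H z) + F z * H z \<partial>?N)"
    by (simp add: algebra_simps)
  also have "\<dots> = (\<integral>z. F z * (G z - H z) \<partial>?N) + (\<integral>z. F z * H z \<partial>?N)"
    by (rule Bochner_Integration.integral_add[OF FGH_int FH_int])
  also have "(\<integral>z. F z * (G z - H z) \<partial>?N) \<le> (\<integral>z. max (F z) 0 \<partial>?N)"
  proof (rule integral_mono[OF FGH_int])
    show "integrable ?N (\<lambda>z. max (F z) 0)"
      using F_int by simp
    fix z assume "z \<in> space ?N"
    then have "0 \<le> G z - H z" "G z - H z \<le> 1"
      using gap by auto
    then have "F z * (G z - H z) \<le> max (F z) 0 * (G z - H z)" "max (F z) 0 * (G z - H z) \<le> max (F z) 0 * 1"
      by (intro mult_right_mono mult_left_mono; simp)+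
    then show "F z * (G z - H z) \<le> max (F z) 0"
      by simp
  qed
  also have "(\<integral>z. max (F z) 0 \<partial>?N) = (\<integral>x. max (f x) 0 \<partial>power_measure M (Suc n))"
    using integral_case_nat_power[OF f_pos] by (simp add: F_def split_beta')
  also have "(\<integral>z. F z * H z \<partial>?N) = (\<integral>x. marginal M f x * h x \<partial>power_measure M n)"
    using integral_marginal_mult[OF f, of h] FH_int by (simp add: F_def H_def split_beta')
  also have "\<dots> \<le> Psi M n (marginal M f)"
    by (rule Suc.IH[OF integrable_marginal[OF f] h_range h_lip])
  finally show ?case
    by simp
qed

section \<open>The \<open>\<ell>\<^sub>p\<close> cubes\<close>

lemma diam_lp_cube_le:
  assumes "1 \<le> p" and "1 \<le> n"
  shows "diam ({..<n} \<rightarrow>\<^sub>E {0..1}) (\<lambda>x y. lp_norm p n (\<lambda>i. x i - y i)) \<le> ereal (real n)"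
  unfolding diam_def
proof (intro SUP_least)
  fix x y :: "nat \<Rightarrow> real"
  assume xy: "x \<in> {..<n} \<rightarrow>\<^sub>E {0..1}" "y \<in> {..<n} \<rightarrow>\<^sub>E {0..1}"
  have "lp_norm p n (\<lambda>i. x i - y i) \<le> (\<Sum>i<n. \<bar>x i - y i\<bar>)"
    by (rule lp_norm_le_sum[OF assms])
  also have "\<dots> \<le> (\<Sum>i<n. 1)"
  proof (rule sum_mono)
    fix i assume "i \<in> {..<n}"
    then have "x i \<in> {0..1}" "y i \<in> {0..1}"
      using xy by blast+
    then show "\<bar>x i - y i\<bar> \<le> 1"
      by (auto simp: abs_le_iff)
  qed
  finally show "ereal (lp_norm p n (\<lambda>i. x i - y i)) \<le> ereal (real n)"
    by simp
qed

theorem mainTheorem4: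
  fixes p :: ereal
  assumes "1 < p" and "p \<le> \<infinity>"
  shows "Psi_dominated (restrict_space lborel {0..1::real})
           (\<lambda>n x y. lp_norm p n (\<lambda>i. x i - y i))"
proof -
  define M where "M = restrict_space lborel {0..1::real}"
  let ?d = "\<lambda>n x y. lp_norm p n (\<lambda>i. x i - y i)"
  have p: "1 \<le> p"
    using assms(1) by simp
  have M_sets: "sets M = sets (restrict_space borel {0..1})"
    by (simp add: M_def sets_restrict_space)
  have M_space: "space M = {0..1}"
    by (simp add: M_def space_restrict_space)
  interpret sigma_finite_measure M
    unfolding M_def by (rule sigma_finite_restrict_lborel)
  have space: "space (power_measure M n) = {..<n} \<rightarrow>\<^sub>E {0..1}" for n
    by (simp add: space_PiM M_space)
  have metric: "Metric_space (space (power_measure M n)) (?d n)" if "1 \<le> n" for n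
    by (rule Metric_space_lp_norm[OF p that]) (simp add: space PiE_def)

  have "Psi_dominated M ?d"
    unfolding Psi_dominated_def
  proof (intro conjI allI impI ballI)
    fix n i and x y :: "nat \<Rightarrow> real"
    assume "2 \<le> n" "i < n" "x i = y i"
    then show "?d n x y = ?d (n - 1) (delete_coord n i x) (delete_coord n i y)"
      by (rule lp_norm_delete_coord[OF p])
  next
    fix n :: nat assume "1 \<le> n"
    then show "sets (power_measure M n) = sigma_sets (space (power_measure M n))
        {U. openin (Metric_space.mtopology (space (power_measure M n)) (?d n)) U}"
      by (intro sets_power_measure_eq_metric_borel[OF M_sets] metric)
        (use abs_le_lp_norm[OF p] lp_norm_le_sum[OF p] in auto)
  next
    fix n and A :: "nat \<Rightarrow> real set"
    assume "\<forall>i<n. A i \<in> sets M"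
    then show "emeasure (power_measure M n) (Pi\<^sub>E {..<n} A) = (\<Prod>i<n. emeasure M (A i))"
      by (intro product_sigma_finite.emeasure_PiM[OF product_sigma_finite_const]) auto
  next
    fix n and f :: "(nat \<Rightarrow> real) \<Rightarrow> real"
    assume n: "1 \<le> n" and f: "integrable (power_measure M n) f"
    have lip: "\<bar>g x - g y\<bar> \<le> (\<Sum>i<n. \<bar>x i - y i\<bar>)"
      if "g \<in> Lip (space (power_measure M n)) (?d n)"
        "x \<in> space (power_measure M n)" "y \<in> space (power_measure M n)" for g x y
      using that lp_norm_le_sum[OF p n, of "\<lambda>i. x i - y i"] unfolding Lip_def by fastforce
    have range: "0 \<le> g x \<and> g x \<le> real n"
      if "g \<in> Lip (space (power_measure M n)) (?d n)" "x \<in> space (power_measure M n)" for g x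
    proof -
      have "0 \<le> g x" "ereal (g x) \<le> diam (space (power_measure M n)) (?d n)"
        using that by (auto simp: Lip_def)
      moreover have "diam (space (power_measure M n)) (?d n) \<le> ereal (real n)"
        unfolding space by (rule diam_lp_cube_le[OF p n])
      ultimately show ?thesis
        using order_trans[of "ereal (g x)" _ "ereal (real n)"] by simp
    qed
    show "integrable (power_measure M n) (\<lambda>x. f x * g x)"
      if "g \<in> Lip (space (power_measure M n)) (?d n)" for g
      by (rule integrable_mult_bounded[OF f borel_measurable_l1_Lipschitz[OF M_sets lip[OF that]],
            where c = "real n"]) (use range[OF that] in auto)
    show "(SUP g\<in>Lip (space (power_measure M n)) (?d n). ereal (\<integral>x. f x * g x \<partial>power_measure M n))
        \<le> ereal (Psi M n f)"
    proof (rule SUP_least)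
      fix g assume g: "g \<in> Lip (space (power_measure M n)) (?d n)"
      have "(\<integral>x. f x * g x \<partial>power_measure M n) \<le> Psi M n f"
        by (rule integral_mult_l1_Lipschitz_le_Psi[folded M_def])
          (use f range[OF g] lip[OF g] in blast)+
      then show "ereal (\<integral>x. f x * g x \<partial>power_measure M n) \<le> ereal (Psi M n f)"
        by simp
    qed
  qed (use metric in auto)
  then show ?thesis
    by (simp add: M_def)
qed

end
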